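(* Every execution of the safe-round algorithm (whatever rule is used to select among the admissible candidates) outputs an exact-EF1 matching $X$. Let $t=\delta(A)$. Then $$P_i(X)\le (m-1)(1-t)B_i\qquad\forall i\in F.$$ Consequently, $$\alpha(X)\ge\Gamma_m(t)=\max\left\{t,\frac{1}{m-(m-1)t}\right\}.$$ Moreover, $$\frac{\mathrm{SW}(X)}{\mathrm{OPT}}\ge u_m(t)=t+\frac{1-t}{m}$$ (the welfare ratio being considered when $\mathrm{OPT}>0$).
   Context: Market: $F=\{1,\dots,m\}$ is the set of firms, $W=\{1,\dots,n\}$ the set of workers; firm $i$ values worker $j$ at $a_{ij}\ge 0$, $A=(a_{ij})$, additively: $V_i(T)=\sum_{j\in T}a_{ij}$. A complete matching $X=(X_1,\dots,X_m)$ is a partition of $W$ (parts may be empty); $\mu(j)$ is the employer of $j$. Put $M_j=\max_i a_{ij}$, $d_j=a_{\mu(j)j}$, $B_i=V_i(X_i)$, $\mathrm{SW}(X)=\sum_i B_i$, $\mathrm{OPT}=\sum_j M_j$, and $P_i(X)=\sum_{j\in W}\max\{a_{ij}-d_j,0\}$. If some $a_{ij}>0$, $\delta(A)=\min_{a_{ij}>0}a_{ij}/M_j$; for the all-zero market $\delta(A)=1$. EF1: $X$ is EF1 if for every pair of firms $i,k$ with $X_k\neq\varnothing$ there is $g\in X_k$ with $V_i(X_i)\ge V_i(X_k\setminus\{g\})$. Core: profits $x_i\ge 0$ and wages $y_j\ge 0$ satisfy local financing if $x_i+\sum_{j\in X_i}y_j=B_i$ for all $i$. $(X,x,y)$ is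 in the $\alpha$-core if $\sum_{i\in I}x_i+\sum_{j\in T}y_j\ge\alpha\sum_{j\in T}\max_{i\in I}a_{ij}$ for all nonempty $I\subseteq F$ and all $T\subseteq W$. $\alpha(X)$ is the largest $\alpha$ (supremum in $[0,+\infty]$) for which some nonnegative $x,y$ satisfying local financing make $(X,x,y)$ an element of the $\alpha$-core. Candidate sets: for $U\subseteq W$, $S\subseteq F$, let $\mathcal S(U,S)$ be the set of $(i,j)\in S\times U$ with $a_{ij}>0$, $a_{ij}=\max_{h\in U}a_{ih}$ and $a_{ij}=\max_{r\in S}a_{rj}$ (mutual-top safe edges), and let $\mathcal G(U,S)$ be the set of pairs $(r,h)\in S\times U$ with $a_{rh}>0$ attaining the maximum of $a$ over $S\times U$. Safe-round algorithm: start with all $X_i=\varnothing$, $U=W$. While there are $i\in F$, $j\in U$ with $a_{ij}>0$: start a new round with $S=F$; while there are $i\in S$, $j\in U$ with $a_{ij}>0$, let the admissible candidate set be $\mathcal G(U,S)$ at the first step of the round and $\mathcal S(U,S)$ at later steps of the round, choose any $(i,j)$ in the admissible candidate set (arbitrarily, or by any secondary rule that returns an element of the candidate set), add $j$ to $X_i$, remove $j$ from $U$ and $i$ from $S$. Finally assign the remaining workers (with $a_{ij}=0$ for all $i$) by any fixed rule. *)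

theory Defs
  imports Complex_Main "HOL-Library.Extended_Real" "HOL-Library.Disjoint_Sets"
begin

text \<open>
  A market is given by \<open>m\<close>, \<open>n\<close> and a valuation matrix \<open>a\<close>, of which only the entries with
  \<open>i \<in> {1..m}\<close>, \<open>j \<in> {1..n}\<close> are meaningful.  A matching is the family of its bundles, as a
  function \<open>X\<close> from firms to sets of workers; only \<open>X i\<close> with \<open>i \<in> {1..m}\<close> is meaningful.
\<close>

type_synonym valuation = "nat \<Rightarrow> nat \<Rightarrow> real"
type_synonym bundles = "nat \<Rightarrow> nat set"

definition firms :: "nat \<Rightarrow> nat set" where
  "firms m = {1..m}"

definition workers :: "nat \<Rightarrow> nat set" where
  "workers n = {1..n}"

definition is_market :: "nat \<Rightarrow> nat \<Rightarrow> valuation \<Rightarrow> bool" where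
  "is_market m n a \<longleftrightarrow> 1 \<le> m \<and> (\<forall>i\<in>firms m. \<forall>j\<in>workers n. 0 \<le> a i j)"

definition val :: "valuation \<Rightarrow> nat \<Rightarrow> nat set \<Rightarrow> real" where
  "val a i T = (\<Sum>j\<in>T. a i j)"

definition complete_matching :: "nat \<Rightarrow> nat \<Rightarrow> bundles \<Rightarrow> bool" where
  "complete_matching m n X \<longleftrightarrow>
     (\<Union>i\<in>firms m. X i) = workers n \<and> disjoint_family_on X (firms m)"

definition employer :: "nat \<Rightarrow> bundles \<Rightarrow> nat \<Rightarrow> nat" where
  "employer m X j = (THE i. i \<in> firms m \<and> j \<in> X i)"

definition top_value :: "nat \<Rightarrow> valuation \<Rightarrow> nat \<Rightarrow> real" where
  "top_value m a j = Max ((\<lambda>i. a i j) ` firms m)"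

definition realized_value :: "nat \<Rightarrow> valuation \<Rightarrow> bundles \<Rightarrow> nat \<Rightarrow> real" where
  "realized_value m a X j = a (employer m X j) j"

definition own_value :: "valuation \<Rightarrow> bundles \<Rightarrow> nat \<Rightarrow> real" where
  "own_value a X i = val a i (X i)"

definition social_welfare :: "nat \<Rightarrow> valuation \<Rightarrow> bundles \<Rightarrow> real" where
  "social_welfare m a X = (\<Sum>i\<in>firms m. own_value a X i)"

definition opt_welfare :: "nat \<Rightarrow> nat \<Rightarrow> valuation \<Rightarrow> real" where
  "opt_welfare m n a = (\<Sum>j\<in>workers n. top_value m a j)"

definition poaching :: "nat \<Rightarrow> nat \<Rightarrow> valuation \<Rightarrow> bundles \<Rightarrow> nat \<Rightarrow> real" where
  "poaching m n a X i = (\<Sum>j\<in>workers n. max (a i j - realized_value m a X j) 0)"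

definition delta :: "nat \<Rightarrow> nat \<Rightarrow> valuation \<Rightarrow> real" where
  "delta m n a =
     (if \<exists>i\<in>firms m. \<exists>j\<in>workers n. 0 < a i j
      then Min {a i j / top_value m a j | i j. i \<in> firms m \<and> j \<in> workers n \<and> 0 < a i j}
      else 1)"

definition EF1 :: "nat \<Rightarrow> valuation \<Rightarrow> bundles \<Rightarrow> bool" where
  "EF1 m a X \<longleftrightarrow>
     (\<forall>i\<in>firms m. \<forall>k\<in>firms m. X k \<noteq> {} \<longrightarrow> (\<exists>g\<in>X k. val a i (X i) \<ge> val a i (X k - {g})))"

definition local_financing ::
    "nat \<Rightarrow> valuation \<Rightarrow> bundles \<Rightarrow> (nat \<Rightarrow> real) \<Rightarrow> (nat \<Rightarrow> real) \<Rightarrow> bool" where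
  "local_financing m a X x y \<longleftrightarrow> (\<forall>i\<in>firms m. x i + (\<Sum>j\<in>X i. y j) = own_value a X i)"

definition in_core ::
    "nat \<Rightarrow> nat \<Rightarrow> valuation \<Rightarrow> real \<Rightarrow> bundles \<Rightarrow> (nat \<Rightarrow> real) \<Rightarrow> (nat \<Rightarrow> real) \<Rightarrow> bool" where
  "in_core m n a \<alpha> X x y \<longleftrightarrow>
     (\<forall>i\<in>firms m. 0 \<le> x i) \<and> (\<forall>j\<in>workers n. 0 \<le> y j) \<and> local_financing m a X x y \<and>
     (\<forall>I T. I \<noteq> {} \<and> I \<subseteq> firms m \<and> T \<subseteq> workers n \<longrightarrow>
        (\<Sum>i\<in>I. x i) + (\<Sum>j\<in>T. y j) \<ge> \<alpha> * (\<Sum>j\<in>T. Max ((\<lambda>i. a i j) ` I)))"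

definition core_ratio :: "nat \<Rightarrow> nat \<Rightarrow> valuation \<Rightarrow> bundles \<Rightarrow> ereal" where
  "core_ratio m n a X = Sup {ereal \<alpha> | \<alpha>. 0 \<le> \<alpha> \<and> (\<exists>x y. in_core m n a \<alpha> X x y)}"

definition Gamma_bound :: "nat \<Rightarrow> real \<Rightarrow> real" where
  "Gamma_bound m t = max t (1 / (real m - (real m - 1) * t))"

definition welfare_bound :: "nat \<Rightarrow> real \<Rightarrow> real" where
  "welfare_bound m t = t + (1 - t) / real m"

definition safe_edges :: "valuation \<Rightarrow> nat set \<Rightarrow> nat set \<Rightarrow> (nat \<times> nat) set" where
  "safe_edges a U S =
     {(i, j). i \<in> S \<and> j \<in> U \<and> 0 < a i j \<and>
        a i j = Max ((\<lambda>h. a i h) ` U) \<and> a i j = Max ((\<lambda>r. a r j) ` S)}"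

definition global_edges :: "valuation \<Rightarrow> nat set \<Rightarrow> nat set \<Rightarrow> (nat \<times> nat) set" where
  "global_edges a U S =
     {(r, h). r \<in> S \<and> h \<in> U \<and> 0 < a r h \<and> a r h = Max ((\<lambda>(i, j). a i j) ` (S \<times> U))}"

definition positive_edge :: "valuation \<Rightarrow> nat set \<Rightarrow> nat set \<Rightarrow> bool" where
  "positive_edge a U S \<longleftrightarrow> (\<exists>i\<in>S. \<exists>j\<in>U. 0 < a i j)"

text \<open>
  The safe-round algorithm as a transition system.  \<open>Outer X U\<close> and \<open>Inner b X U S\<close> are the heads
  of the outer and of the inner loop, where \<open>b\<close> tells whether the next choice is the first of its
  round; \<open>Output X\<close> is the final state.  All choice rules, including history-dependent ones, are
  covered by the nondeterminism of the rule \<open>choose\<close>, and every way of assigning the remaining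
  workers by the arbitrary function \<open>\<rho>\<close> in the rule \<open>finish\<close>.
\<close>

datatype sr_state =
    Outer bundles "nat set"
  | Inner bool bundles "nat set" "nat set"
  | Output bundles

inductive sr_step :: "nat \<Rightarrow> valuation \<Rightarrow> sr_state \<Rightarrow> sr_state \<Rightarrow> bool" for m a where
  new_round: "positive_edge a U (firms m) \<Longrightarrow>
    sr_step m a (Outer X U) (Inner True X U (firms m))"
| choose: "positive_edge a U S \<Longrightarrow>
    (i, j) \<in> (if b then global_edges a U S else safe_edges a U S) \<Longrightarrow>
    sr_step m a (Inner b X U S) (Inner False (X(i := insert j (X i))) (U - {j}) (S - {i}))"
| end_round: "\<not> positive_edge a U S \<Longrightarrow>
    sr_step m a (Inner b X U S) (Outer X U)"
| finish: "\<not> positive_edge a U (firms m) \<Longrightarrow> \<forall>j\<in>U. \<rho> j \<in> firms m \<Longrightarrow>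
    sr_step m a (Outer X U) (Output (\<lambda>i. X i \<union> {j \<in> U. \<rho> j = i}))"

definition sr_start :: "nat \<Rightarrow> sr_state" where
  "sr_start n = Outer (\<lambda>_. {}) (workers n)"

definition sr_output :: "nat \<Rightarrow> nat \<Rightarrow> valuation \<Rightarrow> bundles \<Rightarrow> bool" where
  "sr_output m n a X \<longleftrightarrow> (sr_step m a)\<^sup>*\<^sup>* (sr_start n) (Output X)"

text \<open>
  Every execution produces an output: there is no infinite run, and no run gets stuck (for
  instance because the candidate set is empty) before reaching an output.
\<close>

definition sr_always_outputs :: "nat \<Rightarrow> nat \<Rightarrow> valuation \<Rightarrow> bool" where
  "sr_always_outputs m n a \<longleftrightarrow>
     \<not> (\<exists>s. s 0 = sr_start n \<and> (\<forall>k. sr_step m a (s k) (s (Suc k)))) \<and>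
     (\<forall>s. (sr_step m a)\<^sup>*\<^sup>* (sr_start n) s \<longrightarrow> (\<exists>X. s = Output X) \<or> (\<exists>s'. sr_step m a s s'))"

end

theory Submission
  imports Defs
begin

text \<open>
  Every chosen pair, global or safe, is mutually top: the worker is the best remaining one for the
  firm, and the firm is the best waiting one for the worker.  The first property makes the
  round-\<open>r\<close> pick of \<open>i\<close> worth at least as much to \<open>i\<close> as the round-\<open>(r + 1)\<close> pick of \<open>k\<close>, whence
  EF1.  Both together confine the poaching of \<open>i\<close> within a round to the at most \<open>m - 1\<close> workers taken
  after its own pick, each costing at most a \<open>1 - \<delta>\<close> share of that pick.  The core bound follows by
  paying either all of \<open>d\<^sub>j\<close> or only its \<open>1 / (m - (m - 1) \<delta>)\<close> share to each worker.  The
  first pick of a round realizes the largest remaining \<open>M\<^sub>j\<close> in full, while the at most \<open>m - 1\<close>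
  later ones realize at least \<open>\<delta> M\<^sub>j\<close>; this gives the welfare bound.
\<close>

section \<open>Markets and the ratio \<delta>\<close>

locale market =
  fixes m n :: nat and a :: valuation
  assumes is_market: "is_market m n a"
begin

abbreviation F where "F \<equiv> firms m"
abbreviation W where "W \<equiv> workers n"
abbreviation \<delta> where "\<delta> \<equiv> delta m n a"
abbreviation M where "M \<equiv> top_value m a"

lemma finite_firms [simp]: "finite F" and finite_workers [simp]: "finite W"
  by (auto simp: firms_def workers_def)

lemma card_firms [simp]: "card F = m"
  by (simp add: firms_def)

lemma m_pos: "1 \<le> m"
  using is_market by (simp add: is_market_def)

lemma firms_nonempty [simp]: "F \<noteq> {}"
  using m_pos by (simp add: firms_def)

lemma a_nonneg: "i \<in> F \<Longrightarrow> j \<in> W \<Longrightarrow> 0 \<le> a i j"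
  using is_market by (simp add: is_market_def)

lemma le_top_value: "i \<in> F \<Longrightarrow> a i j \<le> M j"
  by (simp add: top_value_def)

lemma top_value_attained: "\<exists>i\<in>F. M j = a i j"
proof -
  have "M j \<in> (\<lambda>i. a i j) ` F"
    unfolding top_value_def by (rule Max_in) auto
  then show ?thesis by auto
qed

lemma top_value_nonneg: "j \<in> W \<Longrightarrow> 0 \<le> M j"
  using top_value_attained[of j] a_nonneg by auto

lemma
  shows delta_nonneg: "0 \<le> \<delta>"
    and delta_le_1: "\<delta> \<le> 1"
    and delta_mult_top_le: "\<And>i j. i \<in> F \<Longrightarrow> j \<in> W \<Longrightarrow> 0 < a i j \<Longrightarrow> \<delta> * M j \<le> a i j"
proof -
  let ?D = "{a i j / M j | i j. i \<in> F \<and> j \<in> W \<and> 0 < a i j}"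
  have fin: "finite ?D"
    by (rule finite_subset[of _ "(\<lambda>(i, j). a i j / M j) ` (F \<times> W)"]) auto
  have Min_le: "Min ?D \<le> a i j / M j" if "i \<in> F" "j \<in> W" "0 < a i j" for i j
    by (rule Min_le[OF fin]) (use that in blast)
  show le: "\<delta> * M j \<le> a i j" if "i \<in> F" "j \<in> W" "0 < a i j" for i j
  proof -
    have "0 < M j" using le_top_value[OF that(1), of j] that(3) by linarith
    moreover have "\<delta> = Min ?D" unfolding delta_def using that by auto
    ultimately show ?thesis using Min_le[OF that] by (simp add: field_simps)
  qed
  show "\<delta> \<le> 1"
  proof (cases "\<exists>i\<in>F. \<exists>j\<in>W. 0 < a i j")
    case True
    then obtain i j where ij: "i \<in> F" "j \<in> W" "0 < a i j" by blast
    have "\<delta> = Min ?D" unfolding delta_def using ij by auto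
    also have "\<dots> \<le> a i j / M j" by (rule Min_le[OF ij])
    also have "\<dots> \<le> 1" using le_top_value[OF ij(1), of j] ij(3) by simp
    finally show ?thesis .
  qed (auto simp: delta_def)
  show "0 \<le> \<delta>"
  proof (cases "\<exists>i\<in>F. \<exists>j\<in>W. 0 < a i j")
    case True
    then have ne: "?D \<noteq> {}" by blast
    have "\<delta> = Min ?D" unfolding delta_def using True by auto
    moreover have "Min ?D \<in> ?D" by (rule Min_in[OF fin ne])
    ultimately show ?thesis using top_value_nonneg by fastforce
  qed (auto simp: delta_def)
qed

section \<open>Sums over matched pairs\<close>

text \<open>Summing bundle by bundle makes sense even while some workers have no
  \<open>employer\<close>, and each new pair contributes exactly one term.\<close>

definition matched_sum :: "(nat \<Rightarrow> nat \<Rightarrow> real) \<Rightarrow> bundles \<Rightarrow> real" where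
  "matched_sum f X = (\<Sum>k\<in>F. \<Sum>j\<in>X k. f k j)"

lemma employer_eq:
  assumes "disjoint_family_on X F" "k \<in> F" "j \<in> X k"
  shows "employer m X j = k"
  unfolding employer_def
  by (rule the_equality) (use assms in \<open>auto simp: disjoint_family_on_def\<close>)

lemma sum_employer_eq_matched_sum:
  assumes "complete_matching m n X"
  shows "(\<Sum>j\<in>W. f (employer m X j) j) = matched_sum f X"
proof -
  have dj: "disjoint_family_on X F" and U: "(\<Union>k\<in>F. X k) = W"
    using assms by (auto simp: complete_matching_def)
  have fin: "\<forall>k\<in>F. finite (X k)"
    using U by (metis UN_upper finite_subset finite_workers)
  have "(\<Sum>j\<in>W. f (employer m X j) j) = (\<Sum>k\<in>F. \<Sum>j\<in>X k. f (employer m X j) j)"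
    unfolding U[symmetric]
    by (rule sum.UNION_disjoint) (use fin dj in \<open>auto simp: disjoint_family_on_def\<close>)
  also have "\<dots> = matched_sum f X"
    unfolding matched_sum_def by (intro sum.cong refl) (simp add: employer_eq[OF dj])
  finally show ?thesis .
qed

subsection \<open>Core payoffs\<close>

lemma Max_coalition_le_top_value:
  assumes "I \<noteq> {}" "I \<subseteq> F"
  shows "Max ((\<lambda>i. a i j) ` I) \<le> M j"
  unfolding top_value_def by (rule Max_mono) (use assms in auto)

text \<open>Each worker alone already receives \<alpha> times the most that any coalition can
  produce with that worker, so summing over \<open>T\<close> suffices even with zero
  profits.\<close>

lemma in_core_all_to_workers:
  assumes "complete_matching m n X" "0 \<le> \<alpha>"
    and "\<And>k j. k \<in> F \<Longrightarrow> j \<in> X k \<Longrightarrow> \<alpha> * M j \<le> a k j"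
  shows "in_core m n a \<alpha> X (\<lambda>_. 0) (realized_value m a X)"
proof -
  have dj: "disjoint_family_on X F" and U: "(\<Union>k\<in>F. X k) = W"
    using assms by (auto simp: complete_matching_def)
  have real_eq: "realized_value m a X j = a k j" if "k \<in> F" "j \<in> X k" for k j
    using employer_eq[OF dj that] by (simp add: realized_value_def)
  have bound: "\<alpha> * M j \<le> realized_value m a X j" if "j \<in> W" for j
    using that assms(3) real_eq U by (metis UN_E)
  have nonneg: "0 \<le> realized_value m a X j" if "j \<in> W" for j
    using bound[OF that] top_value_nonneg[OF that] assms(2) by (meson mult_nonneg_nonneg order_trans)
  have "\<alpha> * (\<Sum>j\<in>T. Max ((\<lambda>i. a i j) ` I)) \<le> (\<Sum>j\<in>T. realized_value m a X j)"
    if "I \<noteq> {}" "I \<subseteq> F" "T \<subseteq> W" for I T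
    unfolding sum_distrib_left
  proof (rule sum_mono)
    fix j assume "j \<in> T"
    have "\<alpha> * Max ((\<lambda>i. a i j) ` I) \<le> \<alpha> * M j"
      by (rule mult_left_mono[OF Max_coalition_le_top_value]) (use that assms(2) in auto)
    also have "\<dots> \<le> realized_value m a X j" using bound that \<open>j \<in> T\<close> by auto
    finally show "\<alpha> * Max ((\<lambda>i. a i j) ` I) \<le> realized_value m a X j" .
  qed
  then show ?thesis
    unfolding in_core_def local_financing_def own_value_def val_def
    using nonneg real_eq by auto
qed

text \<open>What \<open>I\<close> can produce with \<open>T\<close> exceeds the realized values of
  \<open>T\<close> by at most the total poaching of \<open>I\<close>, hence by at most \<rho> times
  the own values of \<open>I\<close>. Division by \<open>1 + \<rho>\<close> turns this into the
  stated payoffs, which split each \<open>own_value\<close> in the ratio \<rho> to 1.\<close>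

lemma in_core_proportional_split:
  assumes "complete_matching m n X" "0 \<le> \<rho>"
    and poach: "\<And>i. i \<in> F \<Longrightarrow> poaching m n a X i \<le> \<rho> * own_value a X i"
  shows "in_core m n a (1 / (1 + \<rho>)) X
    (\<lambda>i. \<rho> / (1 + \<rho>) * own_value a X i) (\<lambda>j. realized_value m a X j / (1 + \<rho>))"
proof -
  have dj: "disjoint_family_on X F" and U: "(\<Union>k\<in>F. X k) = W"
    using assms by (auto simp: complete_matching_def)
  have real_eq: "realized_value m a X j = a k j" if "k \<in> F" "j \<in> X k" for k j
    using employer_eq[OF dj that] by (simp add: realized_value_def)
  have nonneg: "0 \<le> realized_value m a X j" if "j \<in> W" for j
    using that real_eq U a_nonneg by (metis UN_E)
  have own_nonneg: "0 \<le> own_value a X i" if "i \<in> F" for i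
    unfolding own_value_def val_def using that U a_nonneg by (intro sum_nonneg) auto
  have financing: "local_financing m a X
      (\<lambda>i. \<rho> / (1 + \<rho>) * own_value a X i) (\<lambda>j. realized_value m a X j / (1 + \<rho>))"
    unfolding local_financing_def
  proof
    fix i assume i: "i \<in> F"
    have "(\<Sum>j\<in>X i. realized_value m a X j / (1 + \<rho>)) = own_value a X i / (1 + \<rho>)"
      unfolding own_value_def val_def sum_divide_distrib
      by (rule sum.cong) (use i real_eq in auto)
    then show "\<rho> / (1 + \<rho>) * own_value a X i + (\<Sum>j\<in>X i. realized_value m a X j / (1 + \<rho>))
        = own_value a X i"
      using assms(2) by (simp add: field_simps)
  qed
  have "(\<Sum>j\<in>T. Max ((\<lambda>i. a i j) ` I)) / (1 + \<rho>)
      \<le> (\<Sum>i\<in>I. \<rho> / (1 + \<rho>) * own_value a X i) + (\<Sum>j\<in>T. realized_value m a X j / (1 + \<rho>))"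
    if I: "I \<noteq> {}" "I \<subseteq> F" and T: "T \<subseteq> W" for I T
  proof -
    let ?d = "realized_value m a X"
    have finI: "finite I" using I by (meson finite_firms finite_subset)
    \<comment> \<open>The firm attaining the maximum gains over the realized value at most the sum
      of the positive parts of all members; the maximum is thus replaced by a sum whose order can be
      exchanged.\<close>
    have "(\<Sum>j\<in>T. Max ((\<lambda>i. a i j) ` I)) \<le> (\<Sum>j\<in>T. ?d j + (\<Sum>i\<in>I. max (a i j - ?d j) 0))"
    proof (rule sum_mono)
      fix j
      have "Max ((\<lambda>i. a i j) ` I) \<in> (\<lambda>i. a i j) ` I" by (rule Max_in) (use finI I in auto)
      then obtain i where i: "i \<in> I" "Max ((\<lambda>i. a i j) ` I) = a i j" by auto
      have "max (a i j - ?d j) 0 \<le> (\<Sum>i\<in>I. max (a i j - ?d j) 0)"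
        by (rule member_le_sum) (use i finI in auto)
      then show "Max ((\<lambda>i. a i j) ` I) \<le> ?d j + (\<Sum>i\<in>I. max (a i j - ?d j) 0)"
        using i by linarith
    qed
    also have "\<dots> = (\<Sum>j\<in>T. ?d j) + (\<Sum>i\<in>I. \<Sum>j\<in>T. max (a i j - ?d j) 0)"
      by (simp add: sum.distrib sum.swap[of _ I T])
    also have "(\<Sum>i\<in>I. \<Sum>j\<in>T. max (a i j - ?d j) 0) \<le> (\<Sum>i\<in>I. poaching m n a X i)"
      unfolding poaching_def by (intro sum_mono sum_mono2) (use T in auto)
    also have "\<dots> \<le> (\<Sum>i\<in>I. \<rho> * own_value a X i)"
      using poach I by (intro sum_mono) auto
    finally have "(\<Sum>j\<in>T. Max ((\<lambda>i. a i j) ` I)) / (1 + \<rho>)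
        \<le> ((\<Sum>j\<in>T. ?d j) + \<rho> * (\<Sum>i\<in>I. own_value a X i)) / (1 + \<rho>)"
      using assms(2) by (intro divide_right_mono) (auto simp: sum_distrib_left)
    then show ?thesis
      by (simp add: add_divide_distrib flip: sum_divide_distrib sum_distrib_left)
  qed
  then show ?thesis
    unfolding in_core_def using financing nonneg own_nonneg assms(2) by simp
qed

subsection \<open>Invariants of the rounds\<close>

text \<open>Safe-edge membership without \<open>Max\<close>. Both kinds of candidates satisfy it, so
  most step lemmas serve first and later picks alike.\<close>

definition mutual_top :: "nat set \<Rightarrow> nat set \<Rightarrow> nat \<Rightarrow> nat \<Rightarrow> bool" where
  "mutual_top U S i j \<longleftrightarrow> i \<in> S \<and> j \<in> U \<and> 0 < a i j \<and>
     (\<forall>h\<in>U. a i h \<le> a i j) \<and> (\<forall>r\<in>S. a r j \<le> a i j)"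

lemma safe_edges_iff_mutual_top:
  assumes "finite U" "finite S"
  shows "(i, j) \<in> safe_edges a U S \<longleftrightarrow> mutual_top U S i j"
proof (cases "i \<in> S \<and> j \<in> U")
  case True
  have "a i j = Max ((\<lambda>h. a i h) ` U) \<longleftrightarrow> (\<forall>h\<in>U. a i h \<le> a i j)"
    using True assms by (subst eq_commute, subst Max_eq_iff) auto
  moreover have "a i j = Max ((\<lambda>r. a r j) ` S) \<longleftrightarrow> (\<forall>r\<in>S. a r j \<le> a i j)"
    using True assms by (subst eq_commute, subst Max_eq_iff) auto
  ultimately show ?thesis by (auto simp: safe_edges_def mutual_top_def)
qed (auto simp: safe_edges_def mutual_top_def)

lemma global_edgeD:
  assumes "finite U" "finite S" "(i, j) \<in> global_edges a U S" "r \<in> S" "h \<in> U"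
  shows "a r h \<le> a i j"
proof -
  have "a r h \<le> Max ((\<lambda>(i, j). a i j) ` (S \<times> U))"
    by (rule Max_ge) (use assms in auto)
  then show ?thesis using assms(3) by (auto simp: global_edges_def)
qed

text \<open>A maximum over the whole product is also maximal in its row and its column. Hence safe
  edges exist whenever a positive edge does, and later picks never get stuck.\<close>

lemma global_edges_mutual_top:
  assumes "finite U" "finite S" "(i, j) \<in> global_edges a U S"
  shows "mutual_top U S i j"
  using assms global_edgeD[OF assms] by (auto simp: mutual_top_def global_edges_def)

lemma global_edges_nonempty:
  assumes "finite U" "finite S" "positive_edge a U S"
  shows "global_edges a U S \<noteq> {}"
proof -
  let ?A = "(\<lambda>(i, j). a i j) ` (S \<times> U)"
  obtain i j where ij: "i \<in> S" "j \<in> U" "0 < a i j"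
    using assms(3) by (auto simp: positive_edge_def)
  then have "Max ?A \<in> ?A" using assms by (intro Max_in) auto
  then obtain r h where rh: "r \<in> S" "h \<in> U" "a r h = Max ?A" by auto
  have "a i j \<le> Max ?A" by (rule Max_ge) (use ij assms in auto)
  then have "(r, h) \<in> global_edges a U S" using rh ij by (auto simp: global_edges_def)
  then show ?thesis by blast
qed

section \<open>Remaining values and round invariants\<close>

text \<open>The inserted 0, here and in \<open>top_left\<close>, is the value when no worker
  remains; it does not alter a maximum of nonnegative values.\<close>

definition best_left :: "nat \<Rightarrow> nat set \<Rightarrow> real" where
  "best_left i U = Max (insert 0 (a i ` U))"

definition top_left :: "nat set \<Rightarrow> real" where
  "top_left U = Max (insert 0 (M ` U))"

lemma best_left_nonneg: "finite U \<Longrightarrow> 0 \<le> best_left i U"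
  by (simp add: best_left_def)

lemma le_best_left: "finite U \<Longrightarrow> j \<in> U \<Longrightarrow> a i j \<le> best_left i U"
  by (simp add: best_left_def)

lemma best_left_le: "finite U \<Longrightarrow> 0 \<le> c \<Longrightarrow> (\<And>j. j \<in> U \<Longrightarrow> a i j \<le> c) \<Longrightarrow> best_left i U \<le> c"
  by (simp add: best_left_def)

lemma best_left_antimono: "finite U \<Longrightarrow> U' \<subseteq> U \<Longrightarrow> best_left i U' \<le> best_left i U"
  unfolding best_left_def by (rule Max_mono) auto

lemma top_left_nonneg: "finite U \<Longrightarrow> 0 \<le> top_left U"
  by (simp add: top_left_def)

lemma le_top_left: "finite U \<Longrightarrow> j \<in> U \<Longrightarrow> M j \<le> top_left U"
  by (simp add: top_left_def)

lemma top_left_le: "finite U \<Longrightarrow> 0 \<le> c \<Longrightarrow> (\<And>j. j \<in> U \<Longrightarrow> M j \<le> c) \<Longrightarrow> top_left U \<le> c"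
  by (simp add: top_left_def)

lemma top_left_antimono: "finite U \<Longrightarrow> U' \<subseteq> U \<Longrightarrow> top_left U' \<le> top_left U"
  unfolding top_left_def by (rule Max_mono) auto

text \<open>Positivity of the matched pairs is what makes \<open>delta_mult_top_le\<close> apply to
  them. Pairs of value zero arise only in the final assignment.\<close>

definition partial_matching :: "bundles \<Rightarrow> nat set \<Rightarrow> bool" where
  "partial_matching X U \<longleftrightarrow> U \<subseteq> W \<and> (\<Union>k\<in>F. X k) = W - U \<and> disjoint_family_on X F \<and>
     (\<forall>k\<in>F. \<forall>j\<in>X k. 0 < a k j)"

text \<open>
  \<open>S\<close> is the set of firms still waiting in the current round; between rounds \<open>S = F\<close>.
  In the three invariants below, the multiple of \<open>best_left\<close> or \<open>top_left\<close> is a credit that pays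
  for the picks still to come in the round.
\<close>

definition envy_inv :: "bundles \<Rightarrow> nat set \<Rightarrow> nat set \<Rightarrow> bool" where
  "envy_inv X U S \<longleftrightarrow> (\<forall>i\<in>F. \<forall>k\<in>F. i \<noteq> k \<longrightarrow>
     (X k = {} \<and> of_bool (i \<notin> S) * best_left i U \<le> val a i (X i)) \<or>
     (\<exists>g\<in>X k. val a i (X k - {g}) + (of_bool (i \<notin> S) + of_bool (k \<in> S)) * best_left i U
        \<le> val a i (X i)))"

text \<open>\<open>matched_sum (loss i) X\<close> is the poaching potential of \<open>i\<close>
  against the workers matched so far.\<close>

abbreviation loss :: "nat \<Rightarrow> nat \<Rightarrow> nat \<Rightarrow> real" where
  "loss i k j \<equiv> max (a i j - a k j) 0"

definition loss_inv :: "bundles \<Rightarrow> nat set \<Rightarrow> nat set \<Rightarrow> bool" where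
  "loss_inv X U S \<longleftrightarrow> (\<forall>i\<in>F. matched_sum (loss i) X
       + of_bool (i \<notin> S) * (real (card S) * ((1 - \<delta>) * best_left i U))
     \<le> (real m - 1) * (1 - \<delta>) * val a i (X i))"

definition surplus_inv :: "nat \<Rightarrow> bundles \<Rightarrow> nat set \<Rightarrow> bool" where
  "surplus_inv c X U \<longleftrightarrow>
     real c * ((1 - \<delta>) / real m * top_left U)
       \<le> matched_sum (\<lambda>k j. a k j - welfare_bound m \<delta> * M j) X"

section \<open>Effect of one pick on the invariants\<close>

context
  fixes X U S p q X'
  assumes pm: "partial_matching X U" and SF: "S \<subseteq> F" and pq: "mutual_top U S p q"
    and X': "X' = X(p := insert q (X p))"
begin

lemma pq_facts: "p \<in> S" "p \<in> F" "q \<in> U" "q \<in> W" "0 < a p q"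
    "\<And>h. h \<in> U \<Longrightarrow> a p h \<le> a p q" "\<And>r. r \<in> S \<Longrightarrow> a r q \<le> a p q"
    and U_sub: "U \<subseteq> W" and finite_U: "finite U" and finite_S: "finite S"
  using pq SF pm finite_subset[of U W] finite_subset[of S F]
  by (auto simp: mutual_top_def partial_matching_def)

lemma finite_bundle: "k \<in> F \<Longrightarrow> finite (X k)"
  using pm by (metis Diff_subset UN_upper finite_subset finite_workers partial_matching_def)

lemma q_fresh: "k \<in> F \<Longrightarrow> q \<notin> X k"
  using pm pq_facts by (auto simp: partial_matching_def)

lemma val_step: "k \<in> F \<Longrightarrow> val a i (X' k) = val a i (X k) + (if k = p then a i q else 0)"
  using q_fresh finite_bundle by (auto simp: val_def X')

lemma matched_sum_step: "matched_sum f X' = matched_sum f X + f p q"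
proof -
  have "matched_sum f X' = (\<Sum>k\<in>F. (\<Sum>j\<in>X k. f k j) + (if k = p then f k q else 0))"
    unfolding matched_sum_def
    by (rule sum.cong) (use q_fresh finite_bundle in \<open>auto simp: X'\<close>)
  also have "\<dots> = matched_sum f X + f p q"
    using pq_facts by (simp add: sum.distrib matched_sum_def)
  finally show ?thesis .
qed

lemma partial_matching_step: "partial_matching X' (U - {q})"
proof -
  have "(\<Union>k\<in>F. X' k) = W - (U - {q})"
  proof -
    have "(\<Union>k\<in>F. X' k) = insert q (\<Union>k\<in>F. X k)"
      using pq_facts by (auto simp: X' split: if_splits)
    then show ?thesis using pm pq_facts by (auto simp: partial_matching_def)
  qed
  moreover have "disjoint_family_on X' F"
    using pm q_fresh unfolding partial_matching_def disjoint_family_on_def X' by auto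
  ultimately show ?thesis
    using pm pq_facts by (auto simp: partial_matching_def X')
qed

lemma best_left_step: "best_left i (U - {q}) \<le> best_left i U"
  by (rule best_left_antimono[OF finite_U]) auto

lemma best_left_picker: "best_left p U \<le> a p q"
  by (rule best_left_le[OF finite_U]) (use pq_facts in auto)

lemma best_left_step_nonneg: "0 \<le> best_left i (U - {q})"
  by (rule best_left_nonneg) (use finite_U in auto)

text \<open>A pick by \<open>i\<close> adds at least \<open>best_left i U\<close> to its own value
  and raises the credit coefficient by one. A pick by \<open>k\<close> adds at most that much to the
  envied bundle and lowers the coefficient by one. Any other pick can only shrink
  \<open>best_left\<close>.\<close>

lemma envy_inv_step:
  assumes "envy_inv X U S"
  shows "envy_inv X' (U - {q}) (S - {p})"
  unfolding envy_inv_def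
proof (intro ballI impI)
  fix i k assume i: "i \<in> F" and k: "k \<in> F" and ik: "i \<noteq> k"
  note b = best_left_step[of i] le_best_left[OF finite_U pq_facts(3), of i] best_left_step_nonneg[of i]
  consider (empty) "X k = {}" "of_bool (i \<notin> S) * best_left i U \<le> val a i (X i)"
    | (nonempty) g where "g \<in> X k"
      "val a i (X k - {g}) + (of_bool (i \<notin> S) + of_bool (k \<in> S)) * best_left i U \<le> val a i (X i)"
    using assms i k ik unfolding envy_inv_def by blast
  then show "(X' k = {} \<and> of_bool (i \<notin> S - {p}) * best_left i (U - {q}) \<le> val a i (X' i)) \<or>
     (\<exists>g\<in>X' k. val a i (X' k - {g})
        + (of_bool (i \<notin> S - {p}) + of_bool (k \<in> S - {p})) * best_left i (U - {q}) \<le> val a i (X' i))"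
  proof cases
    case empty
    show ?thesis
    proof (cases "k = p")
      case True
      \<comment> \<open>The first worker that \<open>k\<close> ever takes becomes the removed worker
        \<open>g\<close>, so this pick costs no credit.\<close>
      then have "val a i (X' k - {q}) = 0" using empty by (simp add: X' val_def)
      moreover have "q \<in> X' k" using True by (simp add: X')
      ultimately show ?thesis
        using empty(2) True ik b by (intro disjI2 bexI[of _ q]) (auto simp: val_step[OF i] split: if_splits)
    next
      case False
      then have "X' k = {}" using empty by (simp add: X')
      moreover have "0 \<le> val a i (X i)"
        using empty(2) b by (auto simp: of_bool_def split: if_splits)
      ultimately show ?thesis
        using empty(2) b pq_facts(1) best_left_picker
        by (auto simp: val_step[OF i] of_bool_def split: if_splits)
    qed
  next
    case nonempty
    have g: "g \<in> X' k" using nonempty by (auto simp: X')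
    have "val a i (X' k - {g}) = val a i (X k - {g}) + (if k = p then a i q else 0)"
      using nonempty(1) q_fresh[OF k] finite_bundle[OF k] by (auto simp: X' val_def insert_Diff_if)
    then show ?thesis
      using nonempty(2) b pq_facts(1) best_left_picker ik g
      by (intro disjI2 bexI[OF _ g])
        (auto simp: val_step[OF i] of_bool_def algebra_simps split: if_splits)
  qed
qed

text \<open>A worker taken while \<open>i\<close> is still waiting costs \<open>i\<close> nothing; one taken after \<open>i\<close> has
  picked in the current round costs \<open>i\<close> at most a \<open>1 - \<delta>\<close> share of that pick.\<close>

lemma loss_inv_step:
  assumes "loss_inv X U S"
  shows "loss_inv X' (U - {q}) (S - {p})"
  unfolding loss_inv_def
proof
  fix i assume i: "i \<in> F"
  let ?B = "(1 - \<delta>) * best_left i U" and ?B' = "(1 - \<delta>) * best_left i (U - {q})"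
  have IH: "matched_sum (loss i) X + of_bool (i \<notin> S) * (real (card S) * ?B)
      \<le> (real m - 1) * (1 - \<delta>) * val a i (X i)"
    using assms i by (simp add: loss_inv_def)
  have d: "0 \<le> 1 - \<delta>" using delta_le_1 by simp
  have BB': "?B' \<le> ?B" by (rule mult_left_mono[OF best_left_step d])
  have card_pos: "0 < card S" using pq_facts finite_S by (metis card_gt_0_iff empty_iff)
  have card_S: "real (card (S - {p})) = real (card S) - 1"
    using pq_facts finite_S card_pos by (simp add: card_Diff_singleton of_nat_diff)
  have card_le: "card S \<le> m" using card_mono[OF finite_firms SF] by simp
  have step: "real (card (S - {p})) * ?B' \<le> real (card (S - {p})) * ?B"
    by (rule mult_left_mono[OF BB']) simp
  consider "i = p" | "i \<in> S" "i \<noteq> p" | "i \<notin> S" "i \<noteq> p" by blast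
  then show "matched_sum (loss i) X' + of_bool (i \<notin> S - {p}) * (real (card (S - {p})) * ?B')
      \<le> (real m - 1) * (1 - \<delta>) * val a i (X' i)"
  proof cases
    case 1
    have "real (card (S - {p})) * ?B' \<le> (real m - 1) * ((1 - \<delta>) * a p q)"
    proof (rule mult_mono)
      show "real (card (S - {p})) \<le> real m - 1" using card_S card_le by simp
      show "?B' \<le> (1 - \<delta>) * a p q"
        using best_left_step[of i] best_left_picker 1 d by (intro mult_left_mono) auto
      show "0 \<le> real m - 1" using m_pos by simp
      show "0 \<le> ?B'" using d best_left_step_nonneg by simp
    qed
    then show ?thesis
      using IH 1 pq_facts(1) val_step[OF pq_facts(2), of p]
      by (simp add: matched_sum_step distrib_left mult.assoc)
  next
    case 2
    then show ?thesis
      using IH pq_facts(7)[of i] by (simp add: matched_sum_step val_step[OF i])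
  next
    case 3
    \<comment> \<open>Since \<open>p\<close> realizes at least the share \<delta> of
      \<open>M q\<close>, hence of \<open>a i q\<close>, the loss fits into the one unit of credit
      released when \<open>p\<close> leaves \<open>S\<close>.\<close>
    have "loss i p q \<le> (1 - \<delta>) * max (a i q) 0"
    proof -
      have "\<delta> * a i q \<le> \<delta> * M q" using le_top_value[OF i] delta_nonneg by (rule mult_left_mono)
      also have "\<dots> \<le> a p q" by (rule delta_mult_top_le) (use pq_facts in auto)
      finally have "a i q - a p q \<le> (1 - \<delta>) * a i q" by (simp add: algebra_simps)
      then show ?thesis using a_nonneg[OF i pq_facts(4)] d by simp
    qed
    also have "\<dots> \<le> ?B"
      using le_best_left[OF finite_U pq_facts(3), of i] best_left_nonneg[OF finite_U, of i] d
      by (intro mult_left_mono) auto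
    finally have "loss i p q \<le> ?B" .
    then show ?thesis
      using IH 3 step by (simp add: matched_sum_step val_step[OF i] card_S algebra_simps)
  qed
qed

text \<open>A later pick realizes at least \<open>\<delta> * M q\<close>, so it falls short of the
  target by at most \<open>e * M q\<close>, which one unit of credit covers.\<close>

lemma surplus_inv_step:
  assumes "surplus_inv (card S) X U"
  shows "surplus_inv (card (S - {p})) X' (U - {q})"
proof -
  define e where "e = (1 - \<delta>) / real m"
  have e: "0 \<le> e" using delta_le_1 by (simp add: e_def)
  have bound: "welfare_bound m \<delta> = \<delta> + e" by (simp add: welfare_bound_def e_def)
  have card_pos: "0 < card S" using pq_facts finite_S by (metis card_gt_0_iff empty_iff)
  have card_S: "real (card (S - {p})) = real (card S) - 1"
    using pq_facts finite_S card_pos by (simp add: card_Diff_singleton of_nat_diff)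
  have "e * top_left (U - {q}) \<le> e * top_left U"
    by (rule mult_left_mono[OF top_left_antimono[OF finite_U] e]) auto
  then have "real (card (S - {p})) * (e * top_left (U - {q})) \<le> real (card (S - {p})) * (e * top_left U)"
    by (rule mult_left_mono) simp
  moreover have "\<delta> * M q \<le> a p q" by (rule delta_mult_top_le) (use pq_facts in auto)
  moreover have "e * M q \<le> e * top_left U"
    by (rule mult_left_mono[OF le_top_left[OF finite_U] e]) (use pq_facts in auto)
  ultimately show ?thesis
    using assms unfolding surplus_inv_def matched_sum_step card_S bound
    by (simp add: e_def[symmetric] algebra_simps)
qed

text \<open>With all firms waiting, a global maximum realizes \<open>M q\<close> in full and
  dominates every remaining \<open>M h\<close>. Its surplus over the target funds the credit for the
  other \<open>m - 1\<close> firms.\<close>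

lemma surplus_inv_first_step:
  assumes "surplus_inv 0 X U" "S = F" "(p, q) \<in> global_edges a U S"
  shows "surplus_inv (card (S - {p})) X' (U - {q})"
proof -
  let ?e = "(1 - \<delta>) / real m"
  have e: "0 \<le> ?e" using delta_le_1 by simp
  have top: "M h \<le> a p q" if "h \<in> U" for h
    using top_value_attained[of h] global_edgeD[OF finite_U finite_S assms(3)] that assms(2) by auto
  have Mq: "M q = a p q"
    using top[OF pq_facts(3)] le_top_value[OF pq_facts(2), of q] by simp
  have "top_left (U - {q}) \<le> a p q"
    by (rule top_left_le) (use finite_U top pq_facts in auto)
  then have "?e * top_left (U - {q}) \<le> ?e * a p q" using e by (rule mult_left_mono)
  then have "(real m - 1) * (?e * top_left (U - {q})) \<le> (real m - 1) * (?e * a p q)"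
    by (rule mult_left_mono) (use m_pos in simp)
  \<comment> \<open>The welfare constant is chosen so that
    \<open>1 - welfare_bound m \<delta>\<close> equals
    \<open>(m - 1) * (1 - \<delta>) / m\<close>.\<close>
  also have "\<dots> = a p q - welfare_bound m \<delta> * a p q"
    using m_pos by (simp add: welfare_bound_def field_simps)
  finally have "(real m - 1) * (?e * top_left (U - {q})) \<le> a p q - welfare_bound m \<delta> * M q"
    using Mq by simp
  moreover have "real (card (S - {p})) = real m - 1"
    using assms(2) pq_facts m_pos by (simp add: card_Diff_singleton of_nat_diff)
  ultimately show ?thesis
    using assms(1) by (simp add: surplus_inv_def matched_sum_step)
qed

end

section \<open>Closing a round\<close>

lemma best_left_exhausted:
  assumes "finite U" "\<not> positive_edge a U S" "i \<in> S"
  shows "best_left i U = 0"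
proof -
  have "best_left i U \<le> 0"
    by (rule best_left_le[OF assms(1)]) (use assms in \<open>auto simp: positive_edge_def not_less\<close>)
  then show ?thesis using best_left_nonneg[OF assms(1), of i] by linarith
qed

text \<open>The reset to \<open>F\<close> asks for one unit of credit. If \<open>i\<close> has
  picked, the coefficient is already at least one; if \<open>i\<close> still waits, nothing of value
  to it remains and the unit is zero.\<close>

lemma envy_inv_end_round:
  assumes "finite U" "\<not> positive_edge a U S" "envy_inv X U S" "partial_matching X U"
  shows "envy_inv X U F"
  unfolding envy_inv_def
proof (intro ballI impI)
  fix i k assume i: "i \<in> F" and k: "k \<in> F" and ik: "i \<noteq> k"
  have v: "0 \<le> val a i (X i)"
    using assms(4) i a_nonneg unfolding val_def partial_matching_def
    by (intro sum_nonneg) (meson less_imp_le)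
  have "best_left i U \<le> (of_bool (i \<notin> S) + of_bool (k \<in> S)) * best_left i U"
    using best_left_exhausted[OF assms(1,2)] best_left_nonneg[OF assms(1), of i]
    by (cases "i \<in> S") auto
  then show "(X k = {} \<and> of_bool (i \<notin> F) * best_left i U \<le> val a i (X i)) \<or>
     (\<exists>g\<in>X k. val a i (X k - {g}) + (of_bool (i \<notin> F) + of_bool (k \<in> F)) * best_left i U
        \<le> val a i (X i))"
    using assms(3) i k ik v unfolding envy_inv_def by fastforce
qed

text \<open>Unspent credit is nonnegative and can be discarded.\<close>

lemma loss_inv_end_round:
  assumes "finite U" "loss_inv X U S"
  shows "loss_inv X U F"
  unfolding loss_inv_def
proof
  fix i assume i: "i \<in> F"
  have "0 \<le> of_bool (i \<notin> S) * (real (card S) * ((1 - \<delta>) * best_left i U))"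
    using best_left_nonneg[OF assms(1)] delta_le_1 by simp
  then show "matched_sum (loss i) X + of_bool (i \<notin> F) * (real (card F) * ((1 - \<delta>) * best_left i U))
     \<le> (real m - 1) * (1 - \<delta>) * val a i (X i)"
    using assms(2) i unfolding loss_inv_def by fastforce
qed

lemma surplus_inv_end_round:
  assumes "finite U" "surplus_inv c X U"
  shows "surplus_inv 0 X U"
proof -
  have "0 \<le> real c * ((1 - \<delta>) / real m * top_left U)"
    using top_left_nonneg[OF assms(1)] delta_le_1 by simp
  then show ?thesis using assms(2) unfolding surplus_inv_def by simp
qed

section \<open>The final assignment\<close>

text \<open>The clause on \<open>\<delta> * M j\<close> feeds the core payoff with zero profits, the
  one on \<open>loss\<close> the proportional split; the last is the welfare bound cleared of its
  denominator.\<close>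

definition good_output :: "bundles \<Rightarrow> bool" where
  "good_output X \<longleftrightarrow> complete_matching m n X \<and> EF1 m a X \<and>
     (\<forall>k\<in>F. \<forall>j\<in>X k. \<delta> * M j \<le> a k j) \<and>
     (\<forall>i\<in>F. matched_sum (loss i) X \<le> (real m - 1) * (1 - \<delta>) * val a i (X i)) \<and>
     0 \<le> matched_sum (\<lambda>k j. a k j - welfare_bound m \<delta> * M j) X"

text \<open>The leftover workers are worth zero to every firm, so adding them changes no bundle
  value and none of the matched sums.\<close>

lemma good_output_finish:
  assumes pm: "partial_matching X U" and inv: "envy_inv X U F" "loss_inv X U F" "surplus_inv 0 X U"
    and np: "\<not> positive_edge a U F" and \<rho>: "\<forall>j\<in>U. \<rho> j \<in> F"
  shows "good_output (\<lambda>i. X i \<union> {j \<in> U. \<rho> j = i})" (is "good_output ?Y")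
proof -
  have U: "U \<subseteq> W" "(\<Union>k\<in>F. X k) = W - U" "disjoint_family_on X F"
    and pos: "\<And>k j. k \<in> F \<Longrightarrow> j \<in> X k \<Longrightarrow> 0 < a k j"
    using pm by (auto simp: partial_matching_def)
  have finU: "finite U" using U(1) by (rule finite_subset) simp
  have XW: "X k \<subseteq> W - U" if "k \<in> F" for k using U(2) that by blast
  have finX: "finite (X k)" if "k \<in> F" for k
    using XW[OF that] by (meson finite_Diff finite_subset finite_workers)
  have zero: "a i j = 0" if "i \<in> F" "j \<in> U" for i j
    using np a_nonneg[of i j] that U(1) by (force simp: positive_edge_def)
  have Mzero: "M j = 0" if "j \<in> U" for j
    using top_value_attained[of j] zero that by auto
  \<comment> \<open>The set \<open>A\<close> is empty for whole bundles and a singleton for the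
    bundles in EF1.\<close>
  have sum_eq: "(\<Sum>j\<in>?Y k - A. f j) = (\<Sum>j\<in>X k - A. f j)"
    if "k \<in> F" "\<And>j. j \<in> U \<Longrightarrow> f j = 0" for k A and f :: "nat \<Rightarrow> real"
    by (rule sum.mono_neutral_right) (use that finX finU in auto)
  have val_eq: "val a i (?Y k - A) = val a i (X k - A)" if "i \<in> F" "k \<in> F" for i k A
    unfolding val_def by (rule sum_eq) (use that zero in auto)
  note val_eq' = val_eq[where A = "{}", unfolded Diff_empty]
  have ms_eq: "matched_sum f ?Y = matched_sum f X"
    if "\<And>k j. k \<in> F \<Longrightarrow> j \<in> U \<Longrightarrow> f k j = 0" for f
    unfolding matched_sum_def
    by (intro sum.cong refl sum_eq[where A = "{}", unfolded Diff_empty]) (use that in auto)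
  have "complete_matching m n ?Y"
  proof -
    have "(\<Union>k\<in>F. ?Y k) = (\<Union>k\<in>F. X k) \<union> U" using \<rho> by auto
    moreover have "disjoint_family_on ?Y F"
      unfolding disjoint_family_on_def
    proof (intro ballI impI)
      fix k l assume kl: "k \<in> F" "l \<in> F" "k \<noteq> l"
      then have "X k \<inter> X l = {}" using U(3) by (simp add: disjoint_family_on_def)
      then show "?Y k \<inter> ?Y l = {}" using XW[OF kl(1)] XW[OF kl(2)] kl(3) by blast
    qed
    ultimately show ?thesis using U by (auto simp: complete_matching_def)
  qed
  moreover have "EF1 m a ?Y"
    unfolding EF1_def
  proof (intro ballI impI)
    fix i k assume i: "i \<in> F" and k: "k \<in> F" and ne: "?Y k \<noteq> {}"
    have v: "0 \<le> val a i (X i)"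
      unfolding val_def using pos i by (intro sum_nonneg) (meson less_imp_le)
    consider "i = k" | "X k = {}" | g where "g \<in> X k" "val a i (X k - {g}) + best_left i U \<le> val a i (X i)"
      using inv(1) i k unfolding envy_inv_def by fastforce
    then show "\<exists>g\<in>?Y k. val a i (?Y k - {g}) \<le> val a i (?Y i)"
    proof cases
      case 1
      obtain g where g: "g \<in> ?Y k" using ne by blast
      have "val a i (?Y k - {g}) \<le> val a i (?Y i)"
        unfolding val_def 1
        by (rule sum_mono2) (use finX[OF k] finU pos[OF k] zero[OF k] in \<open>auto simp: less_imp_le\<close>)
      then show ?thesis using g by blast
    next
      case 2
      obtain g where g: "g \<in> ?Y k" using ne by blast
      then show ?thesis using v 2 val_eq[OF i k, of "{g}"] val_eq'[OF i i]
        by (intro bexI[OF _ g]) (simp add: val_def)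
    next
      case 3
      then show ?thesis
        using val_eq[OF i k, of "{g}"] val_eq'[OF i i] best_left_nonneg[OF finU, of i]
        by (intro bexI[of _ g]) auto
    qed
  qed
  moreover have "\<delta> * M j \<le> a k j" if "k \<in> F" "j \<in> ?Y k" for k j
    using that delta_mult_top_le[of k j] pos[of k j] XW[of k] Mzero zero by auto
  moreover have "matched_sum (loss i) ?Y \<le> (real m - 1) * (1 - \<delta>) * val a i (?Y i)" if "i \<in> F" for i
    using inv(2) that ms_eq[of "loss i"] zero val_eq'[OF that that] by (simp add: loss_inv_def)
  moreover have "0 \<le> matched_sum (\<lambda>k j. a k j - welfare_bound m \<delta> * M j) ?Y"
    using inv(3) ms_eq[of "\<lambda>k j. a k j - welfare_bound m \<delta> * M j"] zero Mzero
    by (simp add: surplus_inv_def)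
  ultimately show ?thesis by (simp add: good_output_def)
qed

section \<open>Invariance along executions\<close>

text \<open>A fresh round remembers the positive edge that opened it, for termination, and has no
  surplus credit before its first pick.\<close>

fun state_inv :: "sr_state \<Rightarrow> bool" where
  "state_inv (Outer X U) \<longleftrightarrow>
     partial_matching X U \<and> envy_inv X U F \<and> loss_inv X U F \<and> surplus_inv 0 X U"
| "state_inv (Inner b X U S) \<longleftrightarrow>
     S \<subseteq> F \<and> partial_matching X U \<and> envy_inv X U S \<and> loss_inv X U S \<and>
     (if b then S = F \<and> positive_edge a U S \<and> surplus_inv 0 X U else surplus_inv (card S) X U)"
| "state_inv (Output X) \<longleftrightarrow> good_output X"

lemma state_inv_start: "state_inv (sr_start n)"
  by (auto simp: sr_start_def partial_matching_def envy_inv_def loss_inv_def surplus_inv_def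
      matched_sum_def val_def disjoint_family_on_def)

lemma partial_matching_finite: "partial_matching X U \<Longrightarrow> finite U"
  by (meson finite_subset finite_workers partial_matching_def)

lemma candidate_mutual_top:
  assumes "finite U" "finite S" "(i, j) \<in> (if b then global_edges a U S else safe_edges a U S)"
  shows "mutual_top U S i j"
  using assms global_edges_mutual_top safe_edges_iff_mutual_top by (metis (full_types))

lemma state_inv_step:
  assumes "sr_step m a s s'" "state_inv s"
  shows "state_inv s'"
  using assms
proof (cases rule: sr_step.cases)
  case (choose U S i j b X)
  let ?X = "X(i := insert j (X i))"
  have pm: "partial_matching X U" and SF: "S \<subseteq> F"
    and inv: "envy_inv X U S" "loss_inv X U S"
    using assms(2) choose by auto
  have fin: "finite U" "finite S"
    using partial_matching_finite[OF pm] finite_subset[OF SF] by auto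
  have mt: "mutual_top U S i j" using choose(4) by (rule candidate_mutual_top[OF fin])
  note step = pm SF mt refl
  have "surplus_inv (card (S - {i})) ?X (U - {j})"
  proof (cases b)
    case True
    then show ?thesis using surplus_inv_first_step[OF step] assms(2) choose by simp
  next
    case False
    then show ?thesis using surplus_inv_step[OF step] assms(2) choose by simp
  qed
  then show ?thesis
    using choose SF partial_matching_step[OF step] envy_inv_step[OF step inv(1)]
      loss_inv_step[OF step inv(2)] by auto
next
  case (end_round U S b X)
  have pm: "partial_matching X U" using assms(2) end_round by auto
  note fin = partial_matching_finite[OF pm]
  show ?thesis
    using assms(2) end_round pm envy_inv_end_round[OF fin _ _ pm] loss_inv_end_round[OF fin]
      surplus_inv_end_round[OF fin] by (auto split: if_splits)
next
  case (finish U \<rho> X)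
  then show ?thesis using assms(2) good_output_finish[of X U \<rho>] by auto
qed auto

lemma state_inv_reachable:
  assumes "(sr_step m a)\<^sup>*\<^sup>* (sr_start n) s"
  shows "state_inv s"
  using assms by (induction rule: rtranclp_induct) (auto intro: state_inv_start state_inv_step)

subsection \<open>Termination and output\<close>

text \<open>The state \<open>Inner True\<close> may lie below \<open>Outer\<close> since its only successors have lost a
  worker: a round starts only if a positive edge exists, so it cannot end without a pick.\<close>

fun run_measure :: "sr_state \<Rightarrow> nat" where
  "run_measure (Outer X U) = 3 * card U + 2"
| "run_measure (Inner b X U S) = 3 * card U + (if b then 1 else 3)"
| "run_measure (Output X) = 0"

text \<open>A first pick with \<open>c\<close> workers left goes from \<open>3 * c + 1\<close> to
  \<open>3 * (c - 1) + 3\<close>, a decrease of exactly one.\<close>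

lemma run_measure_decreases:
  assumes "sr_step m a s s'" "state_inv s"
  shows "run_measure s' < run_measure s"
  using assms
proof (cases rule: sr_step.cases)
  case (choose U S i j b X)
  then have "finite U" "finite S"
    using assms(2) partial_matching_finite finite_subset[of S F] by auto
  then have "j \<in> U" using candidate_mutual_top choose(4) by (auto simp: mutual_top_def)
  then have "card (U - {j}) < card U" using \<open>finite U\<close> by (rule card_Diff1_less[rotated])
  then show ?thesis using choose by auto
qed (use assms(2) in auto)

lemma sr_always_outputs: "sr_always_outputs m n a"
  unfolding sr_always_outputs_def
proof (intro conjI notI allI impI)
  assume "\<exists>s. s 0 = sr_start n \<and> (\<forall>k. sr_step m a (s k) (s (Suc k)))"
  then obtain s where s: "s 0 = sr_start n" "\<And>k. sr_step m a (s k) (s (Suc k))" by blast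
  have inv: "state_inv (s k)" for k
    by (induction k) (use s state_inv_start state_inv_step in auto)
  have "run_measure (s k) + k \<le> run_measure (s 0)" for k
  proof (induction k)
    case (Suc k)
    then show ?case using run_measure_decreases[OF s(2) inv, of k] by linarith
  qed simp
  from this[of "Suc (run_measure (s 0))"] show False by simp
next
  fix s assume "(sr_step m a)\<^sup>*\<^sup>* (sr_start n) s"
  then have inv: "state_inv s" by (rule state_inv_reachable)
  show "(\<exists>X. s = Output X) \<or> (\<exists>s'. sr_step m a s s')"
  proof (cases s)
    case (Outer X U)
    show ?thesis
    proof (cases "positive_edge a U F")
      case True
      then show ?thesis using Outer sr_step.new_round by blast
    next
      case False
      obtain i where "i \<in> F" using firms_nonempty by blast
      then show ?thesis using Outer sr_step.finish[OF False, of "\<lambda>_. i"] by blast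
    qed
  next
    case (Inner b X U S)
    then have fin: "finite U" "finite S"
      using inv partial_matching_finite finite_subset[of S F] by auto
    show ?thesis
    proof (cases "positive_edge a U S")
      case True
      obtain i j where "(i, j) \<in> global_edges a U S"
        using global_edges_nonempty[OF fin True] by auto
      \<comment> \<open>A global edge is also safe, so the same pair is admissible at either kind of
        step.\<close>
      then have "(i, j) \<in> (if b then global_edges a U S else safe_edges a U S)"
        using global_edges_mutual_top[OF fin] safe_edges_iff_mutual_top[OF fin] by simp
      then show ?thesis using Inner sr_step.choose[OF True] by blast
    next
      case False
      then show ?thesis using Inner sr_step.end_round by blast
    qed
  qed blast
qed

section \<open>Guarantees for the output\<close>

context
  fixes X
  assumes good: "good_output X"
begin

lemma good_output_complete: "complete_matching m n X"
  using good by (simp add: good_output_def)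

lemma good_output_poaching:
  assumes "i \<in> F"
  shows "poaching m n a X i \<le> (real m - 1) * (1 - \<delta>) * own_value a X i"
proof -
  have "poaching m n a X i = matched_sum (loss i) X"
    using sum_employer_eq_matched_sum[OF good_output_complete, of "loss i"]
    by (simp add: poaching_def realized_value_def)
  then show ?thesis using good assms by (simp add: good_output_def own_value_def)
qed

text \<open>Each of the two payoff constructions bounds the supremum from below by one argument of
  the maximum.\<close>

lemma good_output_core_ratio: "ereal (Gamma_bound m \<delta>) \<le> core_ratio m n a X"
proof -
  let ?\<rho> = "(real m - 1) * (1 - \<delta>)"
  have \<rho>: "0 \<le> ?\<rho>" using m_pos delta_le_1 by simp
  have sup: "ereal \<alpha> \<le> core_ratio m n a X" if "0 \<le> \<alpha>" "in_core m n a \<alpha> X x y" for \<alpha> x y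
    unfolding core_ratio_def by (rule Sup_upper) (use that in blast)
  have "ereal \<delta> \<le> core_ratio m n a X"
    by (rule sup[OF delta_nonneg in_core_all_to_workers])
      (use good delta_nonneg in \<open>auto simp: good_output_def\<close>)
  moreover have "ereal (1 / (1 + ?\<rho>)) \<le> core_ratio m n a X"
    by (rule sup[OF _ in_core_proportional_split[OF good_output_complete \<rho> good_output_poaching]])
      (use \<rho> in auto)
  moreover have "1 + ?\<rho> = real m - (real m - 1) * \<delta>" by (simp add: algebra_simps)
  ultimately show ?thesis by (simp add: Gamma_bound_def max_def)
qed

lemma good_output_welfare:
  assumes "opt_welfare m n a > 0"
  shows "welfare_bound m \<delta> \<le> social_welfare m a X / opt_welfare m n a"
proof -
  have "opt_welfare m n a = matched_sum (\<lambda>_. M) X"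
    using sum_employer_eq_matched_sum[OF good_output_complete, of "\<lambda>_. M"]
    by (simp add: opt_welfare_def)
  moreover have "matched_sum (\<lambda>k j. a k j - welfare_bound m \<delta> * M j) X
      = social_welfare m a X - welfare_bound m \<delta> * matched_sum (\<lambda>_. M) X"
    by (simp add: matched_sum_def social_welfare_def own_value_def val_def sum_subtractf sum_distrib_left)
  moreover have "0 \<le> matched_sum (\<lambda>k j. a k j - welfare_bound m \<delta> * M j) X"
    using good by (simp add: good_output_def)
  ultimately show ?thesis using assms by (simp add: pos_le_divide_eq)
qed

end

end

theorem theorem6:
  fixes m n :: nat and a :: valuation and t :: real
  assumes market: "is_market m n a"
    and t: "t = delta m n a"
  shows "sr_always_outputs m n a \<and>
    (\<forall>X. sr_output m n a X \<longrightarrow>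
       complete_matching m n X \<and> EF1 m a X \<and>
       (\<forall>i\<in>firms m. poaching m n a X i \<le> (real m - 1) * (1 - t) * own_value a X i) \<and>
       core_ratio m n a X \<ge> ereal (Gamma_bound m t) \<and>
       (opt_welfare m n a > 0 \<longrightarrow>
          social_welfare m a X / opt_welfare m n a \<ge> welfare_bound m t))"
proof -
  interpret market m n a by standard (rule market)
  have good: "good_output X" if "sr_output m n a X" for X
    using state_inv_reachable[of "Output X"] that by (simp add: sr_output_def)
  then have "EF1 m a X" if "sr_output m n a X" for X
    using that by (simp add: good_output_def)
  with good show ?thesis
    unfolding t using sr_always_outputs good_output_complete good_output_poaching
      good_output_core_ratio good_output_welfare by blast
qed

end
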